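(* Let $r$ be a given (rational) line and let $\gamma$ be a fourth apotome with respect to $r$. If $\omega$ is the line with $\omega^2=r\gamma$, then $\omega$ is a minor line with respect to $r$.
   Context: Lines (straight-line segments) are represented by positive real numbers, and areas of rectangles by products. Two lines (or two areas) are commensurable if their quotient is a rational number, and incommensurable otherwise. Two lines are incommensurable in square if their squares are incommensurable. Fix a line $r$. A line $a$ is rational (with respect to $r$) if $a^2,r^2$ are commensurable; an area is rational if it is commensurable with $r^2$. A line $m$ is medial if there are rational lines $a,b$, incommensurable with each other, such that $m^2=ab$; an area is medial if it equals $m^2$ for some medial line $m$. A line $\gamma$ is an apotome with respect to $r$ if $\gamma=\zeta-\eta$ for lines $\zeta>\eta$ such that $\zeta,\eta$ are incommensurable and $\zeta^2,\eta^2,r^2$ are commensurable. It is a fourth apotome with respect to $r$ if moreover $\zeta$ is commensurable with $r$ and the line $\theta$ with $\theta^2=\zeta^2-\eta^2$ is incommensurable with $\zeta$. A line $\Omega$ is a minor line (with respect to $r$) if there are lines $\Phi>\Psi$ with $\Omega=\Phi-\Psi$ such that $\Phi,\Psi$ are incommensurable in square, $\Phi^2+\Psi^2$ is a rational area, and $\Phi\Psi$ (equivalently $2\Phi\Psi$) is a medial area. *)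

theory Defs
  imports Complex_Main
begin

text \<open>
  Lines and areas are positive reals (the rectangle on lines \<open>a\<close>, \<open>b\<close> is the product \<open>a * b\<close>),
  so one relation serves for lines and for areas.  It is only ever applied to positive reals.
\<close>

definition commensurable :: "real \<Rightarrow> real \<Rightarrow> bool" where
  "commensurable a b \<longleftrightarrow> a / b \<in> \<rat>"

definition incommensurable_in_square :: "real \<Rightarrow> real \<Rightarrow> bool" where
  "incommensurable_in_square a b \<longleftrightarrow> \<not> commensurable (a\<^sup>2) (b\<^sup>2)"

text \<open>
  In what follows the first argument is the reference line \<open>r\<close>.  A rational line is one whose
  square is commensurable with that of \<open>r\<close>; the line itself need not be commensurable with \<open>r\<close>.
\<close>

definition rational_line :: "real \<Rightarrow> real \<Rightarrow> bool" where
  "rational_line r a \<longleftrightarrow> a > 0 \<and> commensurable (a\<^sup>2) (r\<^sup>2)"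

definition rational_area :: "real \<Rightarrow> real \<Rightarrow> bool" where
  "rational_area r A \<longleftrightarrow> A > 0 \<and> commensurable A (r\<^sup>2)"

definition medial_line :: "real \<Rightarrow> real \<Rightarrow> bool" where
  "medial_line r m \<longleftrightarrow> m > 0 \<and>
     (\<exists>a b. rational_line r a \<and> rational_line r b \<and> \<not> commensurable a b \<and> m\<^sup>2 = a * b)"

definition medial_area :: "real \<Rightarrow> real \<Rightarrow> bool" where
  "medial_area r A \<longleftrightarrow> (\<exists>m. medial_line r m \<and> A = m\<^sup>2)"

definition apotome_decomp :: "real \<Rightarrow> real \<Rightarrow> real \<Rightarrow> real \<Rightarrow> bool" where
  "apotome_decomp r \<gamma> \<zeta> \<eta> \<longleftrightarrow>
     0 < \<eta> \<and> \<eta> < \<zeta> \<and> \<gamma> = \<zeta> - \<eta> \<and> \<not> commensurable \<zeta> \<eta> \<and>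
     commensurable (\<zeta>\<^sup>2) (\<eta>\<^sup>2) \<and> commensurable (\<zeta>\<^sup>2) (r\<^sup>2) \<and> commensurable (\<eta>\<^sup>2) (r\<^sup>2)"

definition apotome :: "real \<Rightarrow> real \<Rightarrow> bool" where
  "apotome r \<gamma> \<longleftrightarrow> (\<exists>\<zeta> \<eta>. apotome_decomp r \<gamma> \<zeta> \<eta>)"

definition fourth_apotome :: "real \<Rightarrow> real \<Rightarrow> bool" where
  "fourth_apotome r \<gamma> \<longleftrightarrow>
     (\<exists>\<zeta> \<eta>. apotome_decomp r \<gamma> \<zeta> \<eta> \<and> commensurable \<zeta> r \<and>
        (\<exists>\<theta>>0. \<theta>\<^sup>2 = \<zeta>\<^sup>2 - \<eta>\<^sup>2 \<and> \<not> commensurable \<theta> \<zeta>))"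

definition minor_line :: "real \<Rightarrow> real \<Rightarrow> bool" where
  "minor_line r \<Omega> \<longleftrightarrow>
     (\<exists>\<Phi> \<Psi>. 0 < \<Psi> \<and> \<Psi> < \<Phi> \<and> \<Omega> = \<Phi> - \<Psi> \<and> incommensurable_in_square \<Phi> \<Psi> \<and>
        rational_area r (\<Phi>\<^sup>2 + \<Psi>\<^sup>2) \<and> medial_area r (\<Phi> * \<Psi>))"

end

theory Submission
  imports Defs
begin

text \<open>
  Write \<open>\<gamma> = \<zeta> - \<eta>\<close> with \<open>\<theta>\<^sup>2 = \<zeta>\<^sup>2 - \<eta>\<^sup>2\<close>.  A decomposition
  \<open>\<omega> = \<Phi> - \<Psi>\<close> is sought by matching \<open>\<omega>\<^sup>2 = \<Phi>\<^sup>2 + \<Psi>\<^sup>2 - 2\<Phi>\<Psi>\<close> with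
  \<open>r\<gamma> = r\<zeta> - r\<eta>\<close>: demand \<open>\<Phi>\<^sup>2 + \<Psi>\<^sup>2 = r\<zeta>\<close> and \<open>2\<Phi>\<Psi> = r\<eta>\<close>.  Then
  \<open>\<Phi>\<^sup>2/r\<close> and \<open>\<Psi>\<^sup>2/r\<close> have sum \<open>\<zeta>\<close> and product \<open>\<eta>\<^sup>2/4\<close>, so they are the roots
  \<open>(\<zeta> \<plusminus> \<theta>)/2\<close> of a quadratic with discriminant \<open>\<theta>\<^sup>2\<close>.

  Each hypothesis on \<open>\<gamma>\<close> yields one property of a minor line.  Since \<open>\<zeta>\<close> is commensurable
  with \<open>r\<close>, the area \<open>r\<zeta>\<close> is rational.  Since moreover \<open>\<zeta>\<close>, \<open>\<eta>\<close> are incommensurable,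
  so are \<open>r\<close>, \<open>\<eta>\<close>, and \<open>r\<eta>/2\<close> is medial.  Finally \<open>\<Phi>\<^sup>2/\<Psi>\<^sup>2 = (\<zeta> + \<theta>)/(\<zeta> - \<theta>)\<close> is
  irrational because \<open>\<theta>/\<zeta>\<close> is (lemma \<open>commensurable_of_sum_difference\<close>).
\<close>

lemma commensurable_trans:
  assumes "b \<noteq> 0" "commensurable a b" "commensurable b c"
  shows "commensurable a c"
  using Rats_mult[of "a / b" "b / c"] assms by (simp add: commensurable_def)

text \<open>
  The ratio \<open>y / x\<close> is the image of \<open>q = (x + y) / (x - y)\<close> under the Moebius map
  \<open>q \<mapsto> (q - 1) / (q + 1)\<close>, whose coefficients are rational.
\<close>

lemma commensurable_of_sum_difference:
  assumes "x \<noteq> y" "commensurable (x + y) (x - y)"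
  shows "commensurable y x"
proof -
  define q where "q = (x + y) / (x - y)"
  have "q - 1 = 2 * y / (x - y)" and "q + 1 = 2 * x / (x - y)"
    using assms(1) by (simp_all add: q_def field_simps)
  then have "y / x = (q - 1) / (q + 1)"
    using assms(1) by simp
  moreover have "q \<in> \<rat>"
    using assms(2) by (simp add: commensurable_def q_def)
  ultimately show ?thesis
    by (simp add: commensurable_def)
qed

lemma rational_area_rectangle:
  assumes "r > 0" "z > 0" "commensurable z r"
  shows "rational_area r (r * z)"
  using assms by (simp add: rational_area_def commensurable_def power2_eq_square)

lemma rational_line_half:
  assumes "rational_line r a"
  shows "rational_line r (a / 2)"
proof -
  have "a\<^sup>2 / r\<^sup>2 / 4 \<in> \<rat>"
    using assms Rats_divide[of "a\<^sup>2 / r\<^sup>2" 4]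
    by (simp add: rational_line_def commensurable_def)
  then show ?thesis
    using assms by (simp add: rational_line_def commensurable_def power_divide mult.commute)
qed

lemma medial_area_rectangle:
  assumes "rational_line r a" "rational_line r b" "\<not> commensurable a b"
  shows "medial_area r (a * b)"
proof -
  have pos: "a * b > 0"
    using assms by (simp add: rational_line_def)
  then have "medial_line r (sqrt (a * b))"
    unfolding medial_line_def using assms by auto
  then show ?thesis
    unfolding medial_area_def using pos by (intro exI[of _ "sqrt (a * b)"]) simp
qed

theorem propositionX:
  fixes r \<gamma> \<omega> :: real
  assumes "r > 0"
    and "fourth_apotome r \<gamma>"
    and "\<omega> > 0" and "\<omega>\<^sup>2 = r * \<gamma>"
  shows "minor_line r \<omega>"
proof -
  obtain \<zeta> \<eta> \<theta> where
    eta: "0 < \<eta>" and eta_less: "\<eta> < \<zeta>" and gamma: "\<gamma> = \<zeta> - \<eta>"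
    and incomm: "\<not> commensurable \<zeta> \<eta>" and eta_sq: "commensurable (\<eta>\<^sup>2) (r\<^sup>2)"
    and zeta_r: "commensurable \<zeta> r" and theta: "0 < \<theta>"
    and theta_sq: "\<theta>\<^sup>2 = \<zeta>\<^sup>2 - \<eta>\<^sup>2" and theta_zeta: "\<not> commensurable \<theta> \<zeta>"
    using assms(2) unfolding fourth_apotome_def apotome_decomp_def by blast
  have theta_less: "\<theta> < \<zeta>"
    using theta_sq eta eta_less by (intro power2_less_imp_less[of \<theta> \<zeta>]) auto
  define \<Phi> \<Psi> where "\<Phi> = sqrt (r * (\<zeta> + \<theta>) / 2)" and "\<Psi> = sqrt (r * (\<zeta> - \<theta>) / 2)"
  have Phi_sq: "\<Phi>\<^sup>2 = r * (\<zeta> + \<theta>) / 2" and Psi_sq: "\<Psi>\<^sup>2 = r * (\<zeta> - \<theta>) / 2"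
    and Psi: "0 < \<Psi>" and less: "\<Psi> < \<Phi>"
    using assms(1) theta theta_less by (auto simp: \<Phi>_def \<Psi>_def)
  have sum_sq: "\<Phi>\<^sup>2 + \<Psi>\<^sup>2 = r * \<zeta>"
    by (simp add: Phi_sq Psi_sq field_simps)
  have "(\<Phi> * \<Psi>)\<^sup>2 = r\<^sup>2 * (\<zeta>\<^sup>2 - \<theta>\<^sup>2) / 4"
    unfolding power_mult_distrib Phi_sq Psi_sq by (simp add: power2_eq_square algebra_simps)
  also have "\<dots> = (r * (\<eta> / 2))\<^sup>2"
    by (simp add: theta_sq power_mult_distrib power_divide)
  finally have prod: "\<Phi> * \<Psi> = r * (\<eta> / 2)"
    using assms(1) eta Psi less by (simp add: power2_eq_iff_nonneg)
  have "(\<Phi> - \<Psi>)\<^sup>2 = \<omega>\<^sup>2"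
    using sum_sq prod assms(4) gamma by (simp add: power2_diff algebra_simps)
  then have diff: "\<omega> = \<Phi> - \<Psi>"
    using assms(3) less by (simp add: power2_eq_iff_nonneg)
  have "incommensurable_in_square \<Phi> \<Psi>"
    using commensurable_of_sum_difference[of \<zeta> \<theta>] theta_less theta_zeta assms(1)
    by (auto simp: incommensurable_in_square_def commensurable_def Phi_sq Psi_sq)
  moreover have "rational_area r (\<Phi>\<^sup>2 + \<Psi>\<^sup>2)"
    using rational_area_rectangle assms(1) eta eta_less zeta_r by (simp add: sum_sq)
  moreover have "medial_area r (\<Phi> * \<Psi>)"
    unfolding prod
  proof (rule medial_area_rectangle)
    show "rational_line r r"
      using assms(1) by (simp add: rational_line_def commensurable_def)
    show "rational_line r (\<eta> / 2)"
      using eta eta_sq by (intro rational_line_half) (simp add: rational_line_def)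
    show "\<not> commensurable r (\<eta> / 2)"
    proof
      assume "commensurable r (\<eta> / 2)"
      moreover have "commensurable (\<eta> / 2) \<eta>"
        using eta by (simp add: commensurable_def)
      ultimately have "commensurable \<zeta> \<eta>"
        using zeta_r assms(1) eta commensurable_trans[of r \<zeta> "\<eta> / 2"]
          commensurable_trans[of "\<eta> / 2" \<zeta> \<eta>] by simp
      with incomm show False ..
    qed
  qed
  ultimately show ?thesis
    unfolding minor_line_def using Psi less diff by blast
qed

end
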